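(* Let $\alpha\in(0,2]$ and $\nu>0$. Let $X_1,X_2,\ldots$ be independent (not necessarily identically distributed) random variables with $\mathsf{E}X_i=0$ and $0<\sigma_i^2=\mathsf{Var}X_i<\infty$, and set $S^*_n=X_1+\ldots+X_n$, $B_n^2=\sigma_1^2+\ldots+\sigma_n^2$. Assume the Lindeberg condition: for every $\tau>0$, $$\lim_{n\to\infty}\frac{1}{B_n^2}\sum_{i=1}^n\int_{|x|\ge\tau B_n}x^2\,d\mathsf{P}(X_i<x)=0.$$ Let $N_1,N_2,\ldots$ be nonnegative integer-valued random variables such that for each $n$, $N_n$ is independent of $X_1,X_2,\ldots$, and $N_n\to\infty$ in probability (i.e. $\mathsf{P}(N_n\le m)\to0$ for every $m$). Let $S^*_{N_n}=X_1+\ldots+X_{N_n}$ (with the empty sum equal to $0$), and let $d_n>0$, $d_n\to\infty$. Then $$\frac{S^*_{N_n}}{d_n}\Longrightarrow L_{\alpha,\nu}$$ if and only if $$\frac{B^2_{N_n}}{d_n^2}\Longrightarrow 2M_{\alpha/2,\nu}.$$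
   Context: $\Longrightarrow$ denotes convergence in distribution as $n\to\infty$. $L_{\alpha,\nu}$ denotes a random variable with characteristic function $(1+|t|^{\alpha})^{-\nu}$, $t\in\mathbb{R}$. For $\delta\in(0,1]$, $\nu>0$, $M_{\delta,\nu}$ denotes a nonnegative random variable with Laplace transform $(1+s^{\delta})^{-\nu}$, $s\ge0$ (generalized Mittag-Leffler distribution). *)

theory Defs
  imports "HOL-Probability.Probability"
begin

definition is_L_law :: "real \<Rightarrow> real \<Rightarrow> real measure \<Rightarrow> bool" where
  "is_L_law \<alpha> \<nu> \<mu> \<longleftrightarrow> real_distribution \<mu> \<and>
     (\<forall>t. char \<mu> t = complex_of_real ((1 + \<bar>t\<bar> powr \<alpha>) powr (- \<nu>)))"

definition is_ML_law :: "real \<Rightarrow> real \<Rightarrow> real measure \<Rightarrow> bool" where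
  "is_ML_law \<delta> \<nu> \<mu> \<longleftrightarrow> real_distribution \<mu> \<and> (AE x in \<mu>. 0 \<le> x) \<and>
     (\<forall>s\<ge>0. (\<integral>x. exp (- s * x) \<partial>\<mu>) = (1 + s powr \<delta>) powr (- \<nu>))"

definition conv_in_dist_L :: "'a measure \<Rightarrow> (nat \<Rightarrow> 'a \<Rightarrow> real) \<Rightarrow> real \<Rightarrow> real \<Rightarrow> bool" where
  "conv_in_dist_L M Y \<alpha> \<nu> \<longleftrightarrow>
     (\<exists>\<mu>. is_L_law \<alpha> \<nu> \<mu> \<and> weak_conv_m (\<lambda>n. distr M borel (Y n)) \<mu>)"

definition conv_in_dist_cML :: "'a measure \<Rightarrow> (nat \<Rightarrow> 'a \<Rightarrow> real) \<Rightarrow> real \<Rightarrow> real \<Rightarrow> real \<Rightarrow> bool" where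
  "conv_in_dist_cML M Y c \<delta> \<nu> \<longleftrightarrow>
     (\<exists>\<mu>. is_ML_law \<delta> \<nu> \<mu> \<and>
          weak_conv_m (\<lambda>n. distr M borel (Y n)) (distr \<mu> borel (\<lambda>x. c * x)))"

end

theory Submission
  imports Defs
begin

text \<open>
  Let \<open>F k\<close> be the characteristic function of \<open>S\<^sub>k / B\<^sub>k\<close> and \<open>U\<^sub>n = B\<^sup>2 / d\<^sub>n\<^sup>2\<close> with \<open>B\<close> taken at the
  random index \<open>N\<^sub>n\<close>. Conditioning on \<open>N\<^sub>n\<close>, the characteristic function of the normalized random sum
  at \<open>t\<close> is the expectation of \<open>F N\<^sub>n (t \<sqdot> sqrt U\<^sub>n)\<close>. The Lindeberg condition gives
  \<open>F k s \<longlongrightarrow> exp (- s\<^sup>2 / 2)\<close> locally uniformly in \<open>s\<close>, so as soon as the laws of \<open>U\<^sub>n\<close> are tight,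
  this expectation is asymptotically the Laplace transform of \<open>U\<^sub>n\<close> at \<open>t\<^sup>2 / 2\<close>.

  If \<open>U\<^sub>n\<close> converges, tightness is automatic and Levy's theorem applies; the limit law is realized as
  a Gaussian scale mixture. Conversely, if the random sums converge, tightness of \<open>U\<^sub>n\<close> follows because
  \<open>S\<^sub>k / B\<^sub>k\<close> is asymptotically not concentrated near 0. Then the Laplace transforms of \<open>U\<^sub>n\<close> converge, and
  Helly selection together with the uniqueness of Laplace transforms yields both the existence of the
  limit law and the convergence.
\<close>

subsection \<open>Uniqueness of Laplace transforms\<close>

text \<open>On \<open>[-1, 1]\<close> all absolute moments are at most 1, so the Taylor remainder of
  the characteristic function is at most \<open>2 * \<bar>t\<bar> ^ n / fact n\<close>. The moments
  therefore determine the characteristic function, and Levy's uniqueness theorem applies.\<close>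

lemma real_distribution_eq_if_moments_eq:
  assumes "real_distribution \<mu>" "real_distribution \<eta>"
    and bnd: "AE x in \<mu>. \<bar>x\<bar> \<le> 1" "AE x in \<eta>. \<bar>x\<bar> \<le> 1"
    and moments: "\<And>k. (\<integral>x. x ^ k \<partial>\<mu>) = (\<integral>x. x ^ k \<partial>\<eta>)"
  shows "\<mu> = \<eta>"
proof -
  have char_lim: "(\<lambda>n. \<Sum>k\<le>n. ((\<i> * t)^k / fact k) * (\<integral>x. x ^ k \<partial>\<rho>)) \<longlonglongrightarrow> char \<rho> t"
    if "real_distribution \<rho>" "AE x in \<rho>. \<bar>x\<bar> \<le> 1" for \<rho> t
  proof -
    interpret real_distribution \<rho> by fact
    have int: "integrable \<rho> (\<lambda>x. x ^ k)" for k
      by (rule integrable_const_bound[where B=1])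
        (use that(2) in \<open>auto simp: power_abs power_le_one\<close>)
    have le1: "expectation (\<lambda>x. \<bar>x\<bar> ^ n) \<le> 1" for n
    proof (rule integral_le_const)
      show "integrable \<rho> (\<lambda>x. \<bar>x\<bar> ^ n)"
        using integrable_abs[OF int] by (simp add: power_abs)
      show "AE x in \<rho>. \<bar>x\<bar> ^ n \<le> 1"
        using that(2) by eventually_elim (simp add: power_le_one)
    qed
    have bound: "cmod ((\<Sum>k\<le>n. ((\<i> * t)^k / fact k) * expectation (\<lambda>x. x ^ k)) - char \<rho> t)
        \<le> 2 * (\<bar>t\<bar> ^ n / fact n)" for n
    proof -
      have "cmod (char \<rho> t - (\<Sum>k\<le>n. ((\<i> * t)^k / fact k) * expectation (\<lambda>x. x ^ k)))
          \<le> (2 * \<bar>t\<bar> ^ n / fact n) * expectation (\<lambda>x. \<bar>x\<bar> ^ n)"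
        by (rule char_approx1) (rule int)
      also have "\<dots> \<le> (2 * \<bar>t\<bar> ^ n / fact n) * 1"
        by (intro mult_left_mono le1) auto
      finally show ?thesis by (simp add: norm_minus_commute)
    qed
    have "(\<lambda>n. 2 * (\<bar>t\<bar> ^ n / fact n)) \<longlonglongrightarrow> 0"
      using tendsto_mult_right_zero[OF summable_LIMSEQ_zero[OF summable_exp[of "\<bar>t\<bar>"]], of 2]
      by (simp add: field_simps)
    then have "(\<lambda>n. (\<Sum>k\<le>n. ((\<i> * t)^k / fact k) * expectation (\<lambda>x. x ^ k)) - char \<rho> t) \<longlonglongrightarrow> 0"
      by (rule Lim_null_comparison[rotated]) (intro always_eventually allI bound)
    then show ?thesis by (simp add: LIM_zero_iff)
  qed
  have "char \<mu> t = char \<eta> t" for t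
    using char_lim[OF assms(1) bnd(1), of t] char_lim[OF assms(2) bnd(2), of t]
    unfolding moments by (rule LIMSEQ_unique)
  then show ?thesis
    by (intro Levy_uniqueness assms ext)
qed

text \<open>The map \<open>x \<mapsto> exp (- x)\<close> turns the Laplace transform at the natural numbers into the moments
  of a distribution on the unit interval.\<close>

lemma real_distribution_eq_if_Laplace_eq:
  assumes "real_distribution \<mu>" "real_distribution \<eta>"
    and nonneg: "AE x in \<mu>. 0 \<le> x" "AE x in \<eta>. 0 \<le> x"
    and Laplace: "\<And>s. 0 \<le> s \<Longrightarrow> (\<integral>x. exp (- s * x) \<partial>\<mu>) = (\<integral>x. exp (- s * x) \<partial>\<eta>)"
  shows "\<mu> = \<eta>"
proof -
  let ?e = "\<lambda>x::real. exp (- x)"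
  interpret \<mu>: real_distribution \<mu> by fact
  interpret \<eta>: real_distribution \<eta> by fact
  have moments: "(\<integral>x. x ^ k \<partial>distr \<rho> borel ?e) = (\<integral>x. exp (- real k * x) \<partial>\<rho>)"
    if "real_distribution \<rho>" for \<rho> k
  proof -
    interpret real_distribution \<rho> by fact
    show ?thesis
      by (subst integral_distr) (auto simp flip: exp_of_nat_mult)
  qed
  have "distr \<mu> borel ?e = distr \<eta> borel ?e"
  proof (rule real_distribution_eq_if_moments_eq)
    show "AE x in distr \<mu> borel ?e. \<bar>x\<bar> \<le> 1"
      by (subst AE_distr_iff) (use nonneg(1) in auto)
    show "AE x in distr \<eta> borel ?e. \<bar>x\<bar> \<le> 1"
      by (subst AE_distr_iff) (use nonneg(2) in auto)
  qed (use assms in \<open>auto simp: moments\<close>)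
  \<comment> \<open>Since \<open>- ln\<close> inverts \<open>?e\<close>, pushing forward once more
    recovers the original laws.\<close>
  then have "distr (distr \<mu> borel ?e) borel (\<lambda>x. - ln x) = distr (distr \<eta> borel ?e) borel (\<lambda>x. - ln x)"
    by simp
  then show ?thesis
    by (simp add: distr_distr comp_def distr_id2)
qed

subsection \<open>Tightness and weak limits of nonnegative laws\<close>

text \<open>The tail bound is only required eventually in \<open>n\<close>, which is the form that
  limit arguments deliver.\<close>

definition asymptotically_tight :: "(nat \<Rightarrow> real measure) \<Rightarrow> bool" where
  "asymptotically_tight \<mu> \<longleftrightarrow>
     (\<forall>\<epsilon>>0. \<exists>R>0. \<forall>\<^sub>F n in sequentially. measure (\<mu> n) {x. R < \<bar>x\<bar>} < \<epsilon>)"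

lemma weak_conv_m_imp_asymptotically_tight:
  assumes "\<And>n. real_distribution (\<mu> n)" "real_distribution \<eta>" "weak_conv_m \<mu> \<eta>"
  shows "asymptotically_tight \<mu>"
  unfolding asymptotically_tight_def
proof (intro allI impI)
  fix \<epsilon> :: real assume "0 < \<epsilon>"
  interpret \<mu>: real_distribution "\<mu> n" for n by fact
  interpret \<eta>: real_distribution \<eta> by fact
  \<comment> \<open>\<open>h k\<close> is a continuous cutoff: 0 on
    \<open>\<bar>x\<bar> \<le> k\<close> and 1 on \<open>\<bar>x\<bar> \<ge> k + 1\<close>. It
    dominates the tail indicator and is admissible as a test function for weak convergence.\<close>
  define h :: "nat \<Rightarrow> real \<Rightarrow> real" where "h k x = max 0 (min 1 (\<bar>x\<bar> - real k))" for k x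
  have h_bdd: "0 \<le> h k x" "h k x \<le> 1" for k x
    by (auto simp: h_def)
  have h_cont: "isCont (h k) x" for k x
    unfolding h_def by (intro continuous_intros)
  have [measurable]: "h k \<in> borel_measurable borel" for k
    unfolding h_def by measurable
  have "(\<lambda>k. \<integral>x. h k x \<partial>\<eta>) \<longlonglongrightarrow> (\<integral>x. 0 \<partial>\<eta>)"
  proof (rule integral_dominated_convergence[where w="\<lambda>_. 1"])
    show "AE x in \<eta>. (\<lambda>k. h k x) \<longlonglongrightarrow> 0"
    proof (rule AE_I2)
      fix x
      have "\<forall>\<^sub>F k in sequentially. h k x = 0"
        using eventually_ge_at_top[of "nat \<lceil>\<bar>x\<bar>\<rceil>"]
      proof eventually_elim
        case (elim k)
        then have "\<bar>x\<bar> \<le> real k" by linarith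
        then show ?case by (simp add: h_def)
      qed
      then show "(\<lambda>k. h k x) \<longlonglongrightarrow> 0"
        by (rule tendsto_eventually)
    qed
  qed (use h_bdd in auto)
  then have "\<forall>\<^sub>F k in sequentially. (\<integral>x. h k x \<partial>\<eta>) < \<epsilon>"
    using \<open>0 < \<epsilon>\<close> by (intro order_tendstoD) auto
  then obtain k where k: "(\<integral>x. h k x \<partial>\<eta>) < \<epsilon>"
    by (auto simp: eventually_sequentially)
  have "(\<lambda>n. \<integral>x. h k x \<partial>\<mu> n) \<longlonglongrightarrow> (\<integral>x. h k x \<partial>\<eta>)"
    by (rule weak_conv_imp_integral_bdd_continuous_conv[OF assms h_cont, where B=1])
      (use h_bdd in auto)
  then have "\<forall>\<^sub>F n in sequentially. (\<integral>x. h k x \<partial>\<mu> n) < \<epsilon>"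
    using k by (rule order_tendstoD)
  moreover have "measure (\<mu> n) {x. real k + 1 < \<bar>x\<bar>} \<le> (\<integral>x. h k x \<partial>\<mu> n)" for n
  proof -
    have "measure (\<mu> n) {x. real k + 1 < \<bar>x\<bar>} = (\<integral>x. indicator {x. real k + 1 < \<bar>x\<bar>} x \<partial>\<mu> n)"
      by simp
    also have "\<dots> \<le> (\<integral>x. h k x \<partial>\<mu> n)"
    proof (rule integral_mono)
      show "integrable (\<mu> n) (h k)"
        by (rule \<mu>.integrable_const_bound[where B=1]) (use h_bdd in auto)
      show "integrable (\<mu> n) (indicator {x. real k + 1 < \<bar>x\<bar>} :: real \<Rightarrow> real)"
        by (simp add: less_top[symmetric])
    qed (auto simp: h_def indicator_def)
    finally show ?thesis .
  qed
  ultimately have "\<forall>\<^sub>F n in sequentially. measure (\<mu> n) {x. real k + 1 < \<bar>x\<bar>} < \<epsilon>"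
    by (auto elim!: eventually_mono intro: order_le_less_trans)
  then show "\<exists>R>0. \<forall>\<^sub>F n in sequentially. measure (\<mu> n) {x. R < \<bar>x\<bar>} < \<epsilon>"
    by (intro exI[of _ "real k + 1"]) auto
qed

text \<open>Only finitely many laws precede the threshold \<open>n0\<close>, and each single law is
  tight, so one maximum over radii serves all \<open>n\<close>. Helly selection needs this uniform
  form.\<close>

lemma asymptotically_tight_imp_tight:
  assumes rd: "\<And>n. real_distribution (\<mu> n)" and tight: "asymptotically_tight \<mu>"
  shows "tight \<mu>"
  unfolding tight_def
proof (intro conjI allI impI rd)
  fix \<epsilon> :: real assume "0 < \<epsilon>"
  interpret \<mu>: real_distribution "\<mu> n" for n by fact
  obtain R n0 where R: "0 < R" "\<And>n. n0 \<le> n \<Longrightarrow> measure (\<mu> n) {x. R < \<bar>x\<bar>} < \<epsilon>"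
    using tight \<open>0 < \<epsilon>\<close> unfolding asymptotically_tight_def eventually_sequentially by blast
  have "\<exists>r>0. measure (\<mu> n) {x. r < \<bar>x\<bar>} < \<epsilon>" for n
  proof -
    \<comment> \<open>Tightness of a single law comes from the previous lemma applied to a constant
      sequence.\<close>
    have "weak_conv_m (\<lambda>_. \<mu> n) (\<mu> n)"
      by (simp add: weak_conv_m_def weak_conv_def)
    then have "asymptotically_tight (\<lambda>_. \<mu> n)"
      by (rule weak_conv_m_imp_asymptotically_tight[OF rd rd])
    then show ?thesis
      using \<open>0 < \<epsilon>\<close> by (auto simp: asymptotically_tight_def)
  qed
  then obtain r where r: "\<And>n. measure (\<mu> n) {x. r n < \<bar>x\<bar>} < \<epsilon>"
    by metis
  define b where "b = Max (insert R (r ` {..<n0}))"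
  have "R \<le> b" and rb: "n < n0 \<Longrightarrow> r n \<le> b" for n
    by (auto simp: b_def)
  \<comment> \<open>The interval is open on the left, so \<open>b\<close> is enlarged to
    \<open>b + 1\<close> to keep the point \<open>- b\<close> inside.\<close>
  have "1 - \<epsilon> < measure (\<mu> n) {- (b + 1)<..b + 1}" for n
  proof -
    have "measure (\<mu> n) {x. b < \<bar>x\<bar>} < \<epsilon>"
    proof (cases "n < n0")
      case True
      have "measure (\<mu> n) {x. b < \<bar>x\<bar>} \<le> measure (\<mu> n) {x. r n < \<bar>x\<bar>}"
        by (rule \<mu>.finite_measure_mono) (use rb[OF True] in auto)
      then show ?thesis using r[of n] by simp
    next
      case False
      have "measure (\<mu> n) {x. b < \<bar>x\<bar>} \<le> measure (\<mu> n) {x. R < \<bar>x\<bar>}"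
        by (rule \<mu>.finite_measure_mono) (use \<open>R \<le> b\<close> in auto)
      then show ?thesis using R(2)[of n] False by simp
    qed
    moreover have "1 - measure (\<mu> n) {x. b < \<bar>x\<bar>} = measure (\<mu> n) (space (\<mu> n) - {x. b < \<bar>x\<bar>})"
      by (subst \<mu>.prob_compl) auto
    moreover have "\<dots> \<le> measure (\<mu> n) {- (b + 1)<..b + 1}"
      by (rule \<mu>.finite_measure_mono) auto
    ultimately show ?thesis by linarith
  qed
  then show "\<exists>a b. a < b \<and> (\<forall>n. 1 - \<epsilon> < measure (\<mu> n) {a<..b})"
    using \<open>0 < R\<close> \<open>R \<le> b\<close> by (intro exI[of _ "- (b + 1)"] exI[of _ "b + 1"]) auto
qed

text \<open>The test function \<open>max 0 (min 1 (- x))\<close> is bounded, continuous and positive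
  exactly on the negative half-line. Its integrals vanish along the sequence, hence also in the
  limit.\<close>

lemma weak_conv_m_AE_nonneg:
  assumes rd: "\<And>n. real_distribution (\<mu> n)" "real_distribution \<eta>" and conv: "weak_conv_m \<mu> \<eta>"
    and nonneg: "\<And>n. AE x in \<mu> n. 0 \<le> x"
  shows "AE x in \<eta>. 0 \<le> x"
proof -
  interpret \<mu>: real_distribution "\<mu> n" for n by fact
  interpret \<eta>: real_distribution \<eta> by fact
  define h :: "real \<Rightarrow> real" where "h x = max 0 (min 1 (- x))" for x
  have h_cont: "isCont h x" for x
    unfolding h_def by (intro continuous_intros)
  have [measurable]: "h \<in> borel_measurable borel"
    unfolding h_def by measurable
  have "(\<lambda>n. \<integral>x. h x \<partial>\<mu> n) \<longlonglongrightarrow> (\<integral>x. h x \<partial>\<eta>)"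
    by (rule weak_conv_imp_integral_bdd_continuous_conv[OF rd conv h_cont, where B=1])
      (auto simp: h_def)
  moreover have "(\<integral>x. h x \<partial>\<mu> n) = 0" for n
    by (rule integral_eq_zero_AE) (use nonneg[of n] in \<open>auto simp: h_def\<close>)
  ultimately have "(\<integral>x. h x \<partial>\<eta>) = 0"
    by (simp add: LIMSEQ_const_iff)
  moreover have "integrable \<eta> h"
    by (rule \<eta>.integrable_const_bound[where B=1]) (auto simp: h_def)
  ultimately have "AE x in \<eta>. h x = 0"
    by (subst (asm) integral_nonneg_eq_0_iff_AE) (auto simp: h_def)
  then show ?thesis
    by eventually_elim (auto simp: h_def split: if_splits)
qed

text \<open>The function \<open>exp (- s * x)\<close> is unbounded for negative \<open>x\<close>
  when \<open>s > 0\<close>. Replacing \<open>x\<close> by \<open>max 0 x\<close> makes it bounded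
  and continuous without changing the integrals of nonnegative laws.\<close>

lemma weak_conv_m_Laplace:
  assumes rd: "\<And>n. real_distribution (\<mu> n)" "real_distribution \<eta>" and conv: "weak_conv_m \<mu> \<eta>"
    and nonneg: "\<And>n. AE x in \<mu> n. 0 \<le> x" and "0 \<le> s"
  shows "(\<lambda>n. \<integral>x. exp (- s * x) \<partial>\<mu> n) \<longlonglongrightarrow> (\<integral>x. exp (- s * x) \<partial>\<eta>)"
proof -
  interpret \<mu>: real_distribution "\<mu> n" for n by fact
  interpret \<eta>: real_distribution \<eta> by fact
  let ?h = "\<lambda>x. exp (- s * max 0 x)"
  have eq: "(\<integral>x. ?h x \<partial>\<rho>) = (\<integral>x. exp (- s * x) \<partial>\<rho>)"
    if "real_distribution \<rho>" "AE x in \<rho>. 0 \<le> x" for \<rho>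
  proof -
    interpret real_distribution \<rho> by fact
    have "AE x in \<rho>. ?h x = exp (- s * x)"
      using that(2) by eventually_elim simp
    then show ?thesis
      by (intro integral_cong_AE) auto
  qed
  have "isCont ?h x" for x
    by (intro continuous_intros)
  then have "(\<lambda>n. \<integral>x. ?h x \<partial>\<mu> n) \<longlonglongrightarrow> (\<integral>x. ?h x \<partial>\<eta>)"
    by (rule weak_conv_imp_integral_bdd_continuous_conv[OF rd conv, where B=1])
      (use \<open>0 \<le> s\<close> in auto)
  then show ?thesis
    unfolding eq[OF rd(1) nonneg] eq[OF rd(2) weak_conv_m_AE_nonneg[OF rd conv nonneg]] .
qed

text \<open>The witness is the law of \<open>sqrt (2 * x) * z\<close> with \<open>x\<close> drawn
  from \<open>\<mu>\<close> and \<open>z\<close> an independent standard normal variable: given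
  \<open>x\<close>, it is centred normal with variance \<open>2 * x\<close>. It supplies the
  candidate limit for the random sums.\<close>

lemma gaussian_scale_mixture_exists:
  assumes "real_distribution \<mu>" and nonneg: "AE x in \<mu>. 0 \<le> x"
  shows "\<exists>\<eta>. real_distribution \<eta> \<and> (\<forall>t. char \<eta> t = complex_of_real (\<integral>x. exp (- t\<^sup>2 * x) \<partial>\<mu>))"
proof -
  let ?G = std_normal_distribution
  let ?Y = "\<lambda>(x, z). sqrt (2 * x) * z"
  interpret \<mu>: real_distribution \<mu> by fact
  interpret G: real_distribution ?G by (rule real_dist_normal_dist)
  interpret P: pair_prob_space \<mu> ?G ..
  have Y [measurable]: "?Y \<in> borel_measurable (\<mu> \<Otimes>\<^sub>M ?G)"
    by measurable
  have rd: "real_distribution (distr (\<mu> \<Otimes>\<^sub>M ?G) borel ?Y)"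
    by (rule P.P.real_distribution_distr) (rule Y)
  have "char (distr (\<mu> \<Otimes>\<^sub>M ?G) borel ?Y) t = complex_of_real (\<integral>x. exp (- t\<^sup>2 * x) \<partial>\<mu>)" for t
  proof -
    have "char (distr (\<mu> \<Otimes>\<^sub>M ?G) borel ?Y) t
        = (\<integral>p. iexp (t * (sqrt (2 * fst p) * snd p)) \<partial>(\<mu> \<Otimes>\<^sub>M ?G))"
      unfolding char_def by (subst integral_distr) (auto simp: case_prod_beta)
    also have "\<dots> = (\<integral>x. \<integral>z. iexp (t * (sqrt (2 * x) * z)) \<partial>?G \<partial>\<mu>)"
      by (subst P.integral_fst'[symmetric])
        (auto intro!: P.P.integrable_const_bound[where B=1])
    also have "\<dots> = (\<integral>x. char ?G (t * sqrt (2 * x)) \<partial>\<mu>)"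
      by (simp add: char_def mult.assoc)
    also have "\<dots> = (\<integral>x. complex_of_real (exp (- t\<^sup>2 * x)) \<partial>\<mu>)"
    proof (rule integral_cong_AE)
      show "AE x in \<mu>. char ?G (t * sqrt (2 * x)) = complex_of_real (exp (- t\<^sup>2 * x))"
        using nonneg
        by eventually_elim (simp add: char_std_normal_distribution power_mult_distrib)
    qed (auto simp: char_std_normal_distribution)
    finally show ?thesis by simp
  qed
  with rd show ?thesis by blast
qed

subsection \<open>Lindeberg estimate for characteristic functions\<close>

lemma norm_integral_le_integral:
  fixes f :: "'a \<Rightarrow> 'b::{banach, second_countable_topology}"
  assumes "integrable M f" "integrable M g" "\<And>x. x \<in> space M \<Longrightarrow> norm (f x) \<le> g x"
  shows "norm (\<integral>x. f x \<partial>M) \<le> (\<integral>x. g x \<partial>M)"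
  by (rule order_trans[OF integral_norm_bound]) (use assms in \<open>auto intro!: integral_mono\<close>)

lemma abs_exp_minus_linear_le:
  assumes "0 \<le> (x::real)"
  shows "\<bar>exp (- x) - (1 - x)\<bar> \<le> x\<^sup>2 / 2"
proof -
  have "exp (- x) \<le> 1 - x + x\<^sup>2 / 2"
  proof -
    let ?f = "\<lambda>x::real. 1 - x + x\<^sup>2 / 2 - exp (- x)"
    have "?f 0 \<le> ?f x"
    proof (rule DERIV_nonneg_imp_nondecreasing[OF assms])
      fix y :: real assume "0 \<le> y"
      have "(?f has_real_derivative (- 1 + y + exp (- y))) (at y)"
        by (auto intro!: derivative_eq_intros)
      moreover have "0 \<le> - 1 + y + exp (- y)"
        using exp_ge_add_one_self[of "- y"] by simp
      ultimately show "\<exists>z. (?f has_real_derivative z) (at y) \<and> 0 \<le> z" by blast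
    qed
    then show ?thesis by simp
  qed
  then show ?thesis
    using exp_ge_add_one_self[of "- x"] by (simp add: abs_le_iff)
qed

lemma abs_cube_eq: "\<bar>x\<bar> ^ 3 = \<bar>x\<bar> * (x::real)\<^sup>2"
  by (metis power2_abs power3_eq_cube power2_eq_square mult.assoc)

context prob_space
begin

lemma measure_distr_abs_gt:
  assumes [measurable]: "random_variable borel Z"
  shows "measure (distr M borel Z) {x::real. R < \<bar>x\<bar>} = prob {\<omega> \<in> space M. R < \<bar>Z \<omega>\<bar>}"
  by (subst measure_distr) (auto intro!: arg_cong[where f=prob])

lemma expectation_indicator_event:
  assumes "{\<omega> \<in> space M. P \<omega>} \<in> events"
  shows "expectation (indicator {\<omega> \<in> space M. P \<omega>}) = prob {\<omega> \<in> space M. P \<omega>}"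
    and "integrable M (indicator {\<omega> \<in> space M. P \<omega>} :: _ \<Rightarrow> real)"
  using assms by (auto simp: less_top[symmetric] intro!: arg_cong[where f=prob])

text \<open>The second-order Taylor remainder is controlled by the minimum of a quadratic and a
  cubic term. The quadratic bound is used where \<open>c \<le> \<bar>z\<bar>\<close>; elsewhere one
  factor \<open>\<bar>z\<bar>\<close> of the cube is bounded by \<open>c\<close>.\<close>

lemma char_truncated_approx:
  fixes Z :: "'a \<Rightarrow> real"
  assumes [measurable]: "random_variable borel Z" and sq_int [simp]: "integrable M (\<lambda>\<omega>. (Z \<omega>)\<^sup>2)"
    and mean: "expectation Z = 0" and "0 \<le> c"
  shows "cmod (char (distr M borel Z) u - (1 - u\<^sup>2 * variance Z / 2))
      \<le> u\<^sup>2 * expectation (\<lambda>\<omega>. (Z \<omega>)\<^sup>2 * indicator {x. c \<le> \<bar>x\<bar>} (Z \<omega>)) + \<bar>u\<bar> ^ 3 * c * variance Z / 6"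
proof -
  let ?T = "\<lambda>\<omega>. (Z \<omega>)\<^sup>2 * indicator {x. c \<le> \<bar>x\<bar>} (Z \<omega>)"
  have [simp]: "integrable M Z"
    by (rule square_integrable_imp_integrable) simp_all
  have T_int [simp]: "integrable M ?T"
    by (rule Bochner_Integration.integrable_bound[OF sq_int]) (auto simp: indicator_def)
  have pointwise: "min (6 * z\<^sup>2) (\<bar>u\<bar> * \<bar>z\<bar> ^ 3) \<le> 6 * (z\<^sup>2 * indicator {x. c \<le> \<bar>x\<bar>} z) + \<bar>u\<bar> * c * z\<^sup>2"
    for z :: real
  proof (cases "c \<le> \<bar>z\<bar>")
    case True
    then show ?thesis using \<open>0 \<le> c\<close> by (simp add: min.coboundedI1)
  next
    case False
    have "\<bar>u\<bar> * \<bar>z\<bar> ^ 3 = \<bar>u\<bar> * \<bar>z\<bar> * z\<^sup>2"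
      by (simp add: abs_cube_eq)
    also have "\<dots> \<le> \<bar>u\<bar> * c * z\<^sup>2"
      using False by (intro mult_right_mono mult_left_mono) auto
    finally show ?thesis using False by (simp add: min.coboundedI2)
  qed
  have "cmod (char (distr M borel Z) u - (1 - u\<^sup>2 * variance Z / 2))
      \<le> (u\<^sup>2 / 6) * expectation (\<lambda>\<omega>. min (6 * (Z \<omega>)\<^sup>2) (\<bar>u\<bar> * \<bar>Z \<omega>\<bar> ^ 3))"
    by (rule char_approx3') (auto simp: mean)
  also have "expectation (\<lambda>\<omega>. min (6 * (Z \<omega>)\<^sup>2) (\<bar>u\<bar> * \<bar>Z \<omega>\<bar> ^ 3))
      \<le> expectation (\<lambda>\<omega>. 6 * ?T \<omega> + \<bar>u\<bar> * c * (Z \<omega>)\<^sup>2)"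
  proof (rule integral_mono)
    show "integrable M (\<lambda>\<omega>. min (6 * (Z \<omega>)\<^sup>2) (\<bar>u\<bar> * \<bar>Z \<omega>\<bar> ^ 3))"
      by (rule Bochner_Integration.integrable_bound[where f="\<lambda>\<omega>. 6 * (Z \<omega>)\<^sup>2"]) auto
    show "integrable M (\<lambda>\<omega>. 6 * ?T \<omega> + \<bar>u\<bar> * c * (Z \<omega>)\<^sup>2)"
      by (intro Bochner_Integration.integrable_add Bochner_Integration.integrable_mult_right
          sq_int T_int)
  qed (rule pointwise)
  also have "expectation (\<lambda>\<omega>. 6 * ?T \<omega> + \<bar>u\<bar> * c * (Z \<omega>)\<^sup>2)
      = 6 * expectation ?T + \<bar>u\<bar> * c * variance Z"
    by (subst Bochner_Integration.integral_add) (auto simp: mean)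
  finally have "cmod (char (distr M borel Z) u - (1 - u\<^sup>2 * variance Z / 2))
      \<le> u\<^sup>2 / 6 * (6 * expectation ?T + \<bar>u\<bar> * c * variance Z)"
    by (simp add: mult_left_mono)
  also have "\<dots> = u\<^sup>2 * expectation ?T + \<bar>u\<bar> ^ 3 * c * variance Z / 6"
    by (simp add: abs_cube_eq algebra_simps)
  finally show ?thesis .
qed

text \<open>Splitting the second moment at level \<open>c\<close> will show that no single variance
  dominates the total.\<close>

lemma variance_le_truncated:
  fixes Z :: "'a \<Rightarrow> real"
  assumes [measurable]: "random_variable borel Z" and sq_int [simp]: "integrable M (\<lambda>\<omega>. (Z \<omega>)\<^sup>2)"
    and mean: "expectation Z = 0" and "0 \<le> c"
  shows "variance Z \<le> c\<^sup>2 + expectation (\<lambda>\<omega>. (Z \<omega>)\<^sup>2 * indicator {x. c \<le> \<bar>x\<bar>} (Z \<omega>))"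
proof -
  let ?T = "\<lambda>\<omega>. (Z \<omega>)\<^sup>2 * indicator {x. c \<le> \<bar>x\<bar>} (Z \<omega>)"
  have T_int [simp]: "integrable M ?T"
    by (rule Bochner_Integration.integrable_bound[OF sq_int]) (auto simp: indicator_def)
  have pointwise: "z\<^sup>2 \<le> c\<^sup>2 + z\<^sup>2 * indicator {x. c \<le> \<bar>x\<bar>} z" for z :: real
    using \<open>0 \<le> c\<close> by (cases "c \<le> \<bar>z\<bar>") (auto simp: abs_le_square_iff[symmetric])
  have "variance Z = expectation (\<lambda>\<omega>. (Z \<omega>)\<^sup>2)"
    by (simp add: mean)
  also have "\<dots> \<le> expectation (\<lambda>\<omega>. c\<^sup>2 + ?T \<omega>)"
    by (rule integral_mono) (use pointwise in auto)
  also have "\<dots> = c\<^sup>2 + expectation ?T"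
    by (subst Bochner_Integration.integral_add) (auto simp: prob_space)
  finally show ?thesis .
qed

text \<open>Quantitative Lindeberg theorem: each factor of the characteristic function is compared
  with the Gaussian factor of the same variance. All factors have modulus at most 1, so the errors
  merely add up. The explicit dependence on \<open>s\<close> yields local uniformity.\<close>

lemma char_normalized_sum_approx:
  fixes X :: "nat \<Rightarrow> 'a \<Rightarrow> real" and n :: nat and \<tau> s :: real
  assumes X_indep: "indep_vars (\<lambda>_. borel) X UNIV"
    and X_sq_int: "\<And>i. integrable M (\<lambda>\<omega>. (X i \<omega>)\<^sup>2)"
    and X_mean: "\<And>i. expectation (X i) = 0"
    and "0 \<le> \<tau>"
  defines "V \<equiv> \<Sum>i<n. variance (X i)"
  assumes V_pos: "0 < V"
  defines "L \<equiv> (\<Sum>i<n. expectation (\<lambda>\<omega>. (X i \<omega>)\<^sup>2 * indicator {x. \<tau> * sqrt V \<le> \<bar>x\<bar>} (X i \<omega>))) / V"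
  shows "cmod (char (distr M borel (\<lambda>\<omega>. (\<Sum>i<n. X i \<omega>) / sqrt V)) s - exp (- s\<^sup>2 / 2))
      \<le> s\<^sup>2 * L + \<bar>s\<bar> ^ 3 * \<tau> / 6 + s ^ 4 / 8 * (\<tau>\<^sup>2 + L)"
proof -
  define B where "B = sqrt V"
  define u where "u = s / B"
  define v where "v i = variance (X i)" for i
  define T where "T i = expectation (\<lambda>\<omega>. (X i \<omega>)\<^sup>2 * indicator {x. \<tau> * B \<le> \<bar>x\<bar>} (X i \<omega>))" for i
  have B: "0 < B" "B\<^sup>2 = V"
    using V_pos by (auto simp: B_def)
  have V: "V = (\<Sum>i<n. v i)" and L: "L = (\<Sum>i<n. T i) / V"
    unfolding V_def L_def v_def T_def B_def by simp_all
  have [measurable]: "random_variable borel (X i)" for i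
    using X_indep unfolding indep_vars_def2 by simp
  have v_nonneg: "0 \<le> v i" for i
    by (simp add: v_def)
  have T_nonneg: "0 \<le> T i" for i
    by (simp add: T_def)
  have u2: "u\<^sup>2 * V = s\<^sup>2"
    using B V_pos by (simp add: u_def power_divide)
  define \<phi> where "\<phi> i = char (distr M borel (X i)) u" for i
  \<comment> \<open>\<open>\<gamma> i\<close> is the characteristic function at \<open>u\<close> of
    a centred normal law with variance \<open>v i\<close>.\<close>
  define \<gamma> where "\<gamma> i = complex_of_real (exp (- (u\<^sup>2 * v i / 2)))" for i
  have "char (distr M borel (\<lambda>\<omega>. (\<Sum>i<n. X i \<omega>) / sqrt V)) s
      = char (distr M borel (\<lambda>\<omega>. \<Sum>i<n. X i \<omega>)) u"
    unfolding char_def u_def B_def by (simp add: integral_distr)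
  also have "\<dots> = (\<Prod>i<n. \<phi> i)"
    unfolding \<phi>_def by (rule char_distr_sum) (rule indep_vars_subset[OF X_indep], simp)
  finally have char_eq: "char (distr M borel (\<lambda>\<omega>. (\<Sum>i<n. X i \<omega>) / sqrt V)) s = (\<Prod>i<n. \<phi> i)" .
  have "(\<Prod>i<n. \<gamma> i) = complex_of_real (exp (\<Sum>i<n. - (u\<^sup>2 * v i / 2)))"
    by (simp add: \<gamma>_def exp_sum)
  also have "(\<Sum>i<n. - (u\<^sup>2 * v i / 2)) = - s\<^sup>2 / 2"
    by (simp add: sum_negf u2[symmetric] V sum_distrib_left sum_divide_distrib)
  finally have exp_eq: "complex_of_real (exp (- s\<^sup>2 / 2)) = (\<Prod>i<n. \<gamma> i)" by simp
  \<comment> \<open>This is Feller's condition in quantitative form: a small Lindeberg ratio makes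
    every single variance small relative to \<open>V\<close>.\<close>
  have v_le: "v i \<le> (\<tau>\<^sup>2 + L) * V" if "i < n" for i
  proof -
    have "v i \<le> (\<tau> * B)\<^sup>2 + T i"
      unfolding v_def T_def using B \<open>0 \<le> \<tau>\<close>
      by (intro variance_le_truncated) (auto simp: X_mean X_sq_int)
    also have "T i \<le> (\<Sum>i<n. T i)"
      using that T_nonneg by (intro member_le_sum) auto
    also have "\<dots> = L * V"
      using V_pos by (simp add: L)
    finally show ?thesis
      using B(2) by (simp add: power_mult_distrib algebra_simps)
  qed
  have term_le: "cmod (\<phi> i - \<gamma> i)
      \<le> (u\<^sup>2 * T i + \<bar>u\<bar> ^ 3 * (\<tau> * B) * v i / 6) + u ^ 4 / 8 * (\<tau>\<^sup>2 + L) * V * v i" if "i < n" for i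
  proof -
    \<comment> \<open>\<open>?w\<close> is the Taylor polynomial shared by \<open>\<phi> i\<close>
      and \<open>\<gamma> i\<close>; the two are compared through it.\<close>
    let ?w = "complex_of_real (1 - u\<^sup>2 * v i / 2)"
    have "cmod (\<phi> i - ?w) \<le> u\<^sup>2 * T i + \<bar>u\<bar> ^ 3 * (\<tau> * B) * v i / 6"
      using char_truncated_approx[of "X i" "\<tau> * B" u] B \<open>0 \<le> \<tau>\<close>
      by (simp add: \<phi>_def T_def v_def X_mean X_sq_int)
    moreover have "cmod (?w - \<gamma> i) \<le> u ^ 4 / 8 * (\<tau>\<^sup>2 + L) * V * v i"
    proof -
      have "cmod (?w - \<gamma> i) = \<bar>exp (- (u\<^sup>2 * v i / 2)) - (1 - u\<^sup>2 * v i / 2)\<bar>"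
        unfolding \<gamma>_def of_real_diff[symmetric] norm_of_real by (rule abs_minus_commute)
      also have "\<dots> \<le> (u\<^sup>2 * v i / 2)\<^sup>2 / 2"
        by (rule abs_exp_minus_linear_le) (simp add: v_nonneg)
      also have "\<dots> = u ^ 4 / 8 * v i * v i"
        by (simp add: power2_eq_square power4_eq_xxxx)
      also have "\<dots> \<le> u ^ 4 / 8 * ((\<tau>\<^sup>2 + L) * V) * v i"
        by (intro mult_right_mono mult_left_mono v_le that v_nonneg) auto
      finally show ?thesis by (simp add: mult.assoc)
    qed
    ultimately show ?thesis
      by (rule norm_diff_triangle_le)
  qed
  have "cmod ((\<Prod>i<n. \<phi> i) - (\<Prod>i<n. \<gamma> i)) \<le> (\<Sum>i<n. cmod (\<phi> i - \<gamma> i))"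
  proof (rule norm_prod_diff)
    fix i
    show "cmod (\<phi> i) \<le> 1" unfolding \<phi>_def
      by (intro real_distribution.cmod_char_le_1 real_distribution_distr) simp
    show "cmod (\<gamma> i) \<le> 1" unfolding \<gamma>_def norm_of_real by (simp add: v_nonneg)
  qed
  also have "\<dots> \<le> (\<Sum>i<n. (u\<^sup>2 * T i + \<bar>u\<bar> ^ 3 * (\<tau> * B) * v i / 6) + u ^ 4 / 8 * (\<tau>\<^sup>2 + L) * V * v i)"
    by (intro sum_mono term_le) auto
  also have "\<dots> = u\<^sup>2 * (\<Sum>i<n. T i) + \<bar>u\<bar> ^ 3 * (\<tau> * B) * V / 6 + u ^ 4 / 8 * (\<tau>\<^sup>2 + L) * V * V"
    by (simp add: sum.distrib V flip: sum_distrib_left sum_divide_distrib)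
  also have "u\<^sup>2 * (\<Sum>i<n. T i) = s\<^sup>2 * L"
    using V_pos by (simp add: L u2[symmetric])
  also have "\<bar>u\<bar> ^ 3 * (\<tau> * B) * V = \<bar>s\<bar> ^ 3 * \<tau>"
    using B(1) by (simp add: u_def B(2)[symmetric] power_divide power2_eq_square power3_eq_cube)
  also have "u ^ 4 / 8 * (\<tau>\<^sup>2 + L) * V * V = s ^ 4 / 8 * (\<tau>\<^sup>2 + L)"
    using B(1) by (simp add: u_def B(2)[symmetric] power_divide power2_eq_square power4_eq_xxxx)
  finally show ?thesis
    unfolding char_eq exp_eq .
qed

end

subsection \<open>Random sums\<close>

locale lindeberg_random_sum = prob_space +
  fixes X :: "nat \<Rightarrow> 'a \<Rightarrow> real" and N :: "nat \<Rightarrow> 'a \<Rightarrow> nat" and d :: "nat \<Rightarrow> real"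
  assumes X_indep: "indep_vars (\<lambda>_. borel) X UNIV"
    and X_sq_int: "\<And>i. integrable M (\<lambda>\<omega>. (X i \<omega>)\<^sup>2)"
    and X_mean: "\<And>i. expectation (X i) = 0"
    and X_var_pos: "\<And>i. 0 < variance (X i)"
    and Lindeberg: "\<And>\<tau>. \<tau> > 0 \<Longrightarrow>
      (\<lambda>n. (\<Sum>i<n. expectation
              (\<lambda>\<omega>. (X i \<omega>)\<^sup>2 * indicator {x. \<bar>x\<bar> \<ge> \<tau> * sqrt (\<Sum>j<n. variance (X j))} (X i \<omega>)))
           / (\<Sum>j<n. variance (X j))) \<longlonglongrightarrow> 0"
    and N_rv: "\<And>n. N n \<in> measurable M (count_space UNIV)"
    and N_indep: "\<And>n. indep_set
                     {N n -` A \<inter> space M | A. True}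
                     {(\<lambda>\<omega> i. X i \<omega>) -` B \<inter> space M | B. B \<in> sets (PiM UNIV (\<lambda>_. borel))}"
    and N_inf: "\<And>m. (\<lambda>n. prob {\<omega> \<in> space M. N n \<omega> \<le> m}) \<longlonglongrightarrow> 0"
    and d_pos: "\<And>n. 0 < d n"
begin

definition V :: "nat \<Rightarrow> real" where "V k = (\<Sum>j<k. variance (X j))"

text \<open>By the convention \<open>0 / 0 = 0\<close>, the empty sum is normalized to 0 and \<open>F 0\<close> is constantly 1.\<close>

definition F :: "nat \<Rightarrow> real \<Rightarrow> complex" where
  "F k s = char (distr M borel (\<lambda>\<omega>. (\<Sum>i<k. X i \<omega>) / sqrt (V k))) s"

definition U :: "nat \<Rightarrow> 'a \<Rightarrow> real" where "U n \<omega> = V (N n \<omega>) / (d n)\<^sup>2"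

definition Y :: "nat \<Rightarrow> 'a \<Rightarrow> real" where "Y n \<omega> = (\<Sum>i<N n \<omega>. X i \<omega>) / d n"

lemma X_measurable [measurable]: "random_variable borel (X i)"
  using X_indep unfolding indep_vars_def2 by simp

declare N_rv [measurable]

lemma U_measurable [measurable]: "random_variable borel (U n)"
  unfolding U_def by measurable

lemma Y_measurable [measurable]: "random_variable borel (Y n)"
proof -
  have "(\<lambda>\<omega>. (\<lambda>k \<omega>. (\<Sum>i<k. X i \<omega>) / d n) (N n \<omega>) \<omega>) \<in> borel_measurable M"
    by (rule measurable_compose_countable[OF _ N_rv]) measurable
  then show ?thesis by (simp add: Y_def[abs_def])
qed

lemma V_pos: "0 < k \<Longrightarrow> 0 < V k"
  unfolding V_def by (rule sum_pos) (auto simp: X_var_pos)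

lemma V_0 [simp]: "V 0 = 0"
  by (simp add: V_def)

lemma V_nonneg: "0 \<le> V k"
  by (cases "k = 0") (auto intro: less_imp_le V_pos)

lemma U_nonneg: "0 \<le> U n \<omega>"
  by (simp add: U_def V_nonneg)

lemma sqrt_U: "sqrt (U n \<omega>) = sqrt (V (N n \<omega>)) / d n"
  using d_pos[of n] by (simp add: U_def real_sqrt_divide)

lemma cmod_F_le_1: "cmod (F k s) \<le> 1"
  unfolding F_def by (intro real_distribution.cmod_char_le_1 real_distribution_distr) simp

text \<open>Uniformity on compact sets is essential, because \<open>F\<close> will be evaluated at
  the random point \<open>t * sqrt (U n \<omega>)\<close>.\<close>

lemma F_uniform_limit:
  assumes "0 \<le> R" "0 < \<epsilon>"
  shows "\<exists>m>0. \<forall>k\<ge>m. \<forall>s. \<bar>s\<bar> \<le> R \<longrightarrow> cmod (F k s - exp (- s\<^sup>2 / 2)) \<le> \<epsilon>"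
proof -
  \<comment> \<open>\<open>\<tau>\<close> is chosen so that the terms carrying it cost at most
    \<open>\<epsilon> / 2\<close>; the bound 1 gives \<open>\<tau>\<^sup>2 \<le> \<tau>\<close>. The
    summand 1 in the denominator covers \<open>R = 0\<close>. The terms with \<open>L k\<close> use
    the other half.\<close>
  define \<tau> where "\<tau> = min 1 (\<epsilon> / (2 * (R ^ 3 + R ^ 4 + 1)))"
  have pos: "0 < R ^ 3 + R ^ 4 + 1" "0 < R\<^sup>2 + R ^ 4 + 1"
    using assms by (auto intro!: add_nonneg_pos add_nonneg_nonneg)
  have \<tau>: "0 < \<tau>" "\<tau> \<le> 1" "(R ^ 3 + R ^ 4 + 1) * \<tau> \<le> \<epsilon> / 2"
  proof -
    show "0 < \<tau>" "\<tau> \<le> 1" using pos assms by (auto simp: \<tau>_def)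
    have "(R ^ 3 + R ^ 4 + 1) * \<tau> \<le> (R ^ 3 + R ^ 4 + 1) * (\<epsilon> / (2 * (R ^ 3 + R ^ 4 + 1)))"
      using pos by (intro mult_left_mono) (auto simp: \<tau>_def)
    also have "\<dots> = \<epsilon> / 2" using pos by (simp add: field_simps)
    finally show "(R ^ 3 + R ^ 4 + 1) * \<tau> \<le> \<epsilon> / 2" .
  qed
  define L where "L k = (\<Sum>i<k. expectation
      (\<lambda>\<omega>. (X i \<omega>)\<^sup>2 * indicator {x. \<tau> * sqrt (V k) \<le> \<bar>x\<bar>} (X i \<omega>))) / V k" for k
  have "L \<longlonglongrightarrow> 0"
    using Lindeberg[OF \<tau>(1)] by (simp add: L_def[abs_def] V_def[abs_def])
  then have "\<forall>\<^sub>F k in sequentially. L k < \<epsilon> / (2 * (R\<^sup>2 + R ^ 4 + 1))"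
    using pos assms by (intro order_tendstoD) auto
  then obtain m where m: "\<And>k. m \<le> k \<Longrightarrow> L k < \<epsilon> / (2 * (R\<^sup>2 + R ^ 4 + 1))"
    by (auto simp: eventually_sequentially)
  \<comment> \<open>Starting at \<open>Suc m\<close> excludes \<open>k = 0\<close>, where
    \<open>V k\<close> vanishes.\<close>
  have "cmod (F k s - exp (- s\<^sup>2 / 2)) \<le> \<epsilon>" if k: "Suc m \<le> k" and s: "\<bar>s\<bar> \<le> R" for k s
  proof -
    have "0 < V k" using k by (intro V_pos) auto
    have L_nonneg: "0 \<le> L k"
      unfolding L_def using V_nonneg by (intro divide_nonneg_nonneg sum_nonneg) auto
    have s_pow: "s\<^sup>2 \<le> R\<^sup>2" "\<bar>s\<bar> ^ 3 \<le> R ^ 3" "s ^ 4 \<le> R ^ 4"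
      using power_mono[OF s, of 2] power_mono[OF s, of 3] power_mono[OF s, of 4]
      by (auto simp: power_even_abs)
    have "cmod (F k s - exp (- s\<^sup>2 / 2)) \<le> s\<^sup>2 * L k + \<bar>s\<bar> ^ 3 * \<tau> / 6 + s ^ 4 / 8 * (\<tau>\<^sup>2 + L k)"
      using char_normalized_sum_approx[OF X_indep X_sq_int X_mean, of \<tau> k s] \<open>0 < V k\<close> \<open>0 < \<tau>\<close>
      by (simp add: F_def V_def L_def)
    also have "\<dots> \<le> R\<^sup>2 * L k + R ^ 3 * \<tau> + R ^ 4 * (\<tau> + L k)"
    proof (intro add_mono)
      show "s\<^sup>2 * L k \<le> R\<^sup>2 * L k"
        using s_pow L_nonneg by (intro mult_right_mono)
      have "\<bar>s\<bar> ^ 3 * \<tau> / 6 \<le> \<bar>s\<bar> ^ 3 * \<tau>"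
        using \<tau>(1) by simp
      also have "\<dots> \<le> R ^ 3 * \<tau>"
        using s_pow \<tau>(1) by (intro mult_right_mono) auto
      finally show "\<bar>s\<bar> ^ 3 * \<tau> / 6 \<le> R ^ 3 * \<tau>" .
      have "\<tau>\<^sup>2 \<le> \<tau>"
        using \<tau>(1,2) by (simp add: power2_eq_square mult_left_le)
      moreover have "s ^ 4 / 8 \<le> R ^ 4"
      proof -
        have "0 \<le> s ^ 4" by simp
        then show ?thesis using s_pow(3) by linarith
      qed
      ultimately show "s ^ 4 / 8 * (\<tau>\<^sup>2 + L k) \<le> R ^ 4 * (\<tau> + L k)"
        using L_nonneg assms(1) by (intro mult_mono) auto
    qed
    also have "\<dots> \<le> (R ^ 3 + R ^ 4 + 1) * \<tau> + (R\<^sup>2 + R ^ 4 + 1) * L k"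
      using L_nonneg \<tau>(1) by (simp add: algebra_simps)
    also have "\<dots> \<le> \<epsilon> / 2 + (R\<^sup>2 + R ^ 4 + 1) * (\<epsilon> / (2 * (R\<^sup>2 + R ^ 4 + 1)))"
      using m[of k] k pos by (intro add_mono \<tau>(3) mult_left_mono) auto
    also have "\<dots> = \<epsilon>"
      using pos by (simp add: field_simps)
    finally show ?thesis .
  qed
  then show ?thesis by (intro exI[of _ "Suc m"]) auto
qed

section \<open>Conditioning on the random index\<close>

lemma X_seq_measurable [measurable]: "random_variable (PiM UNIV (\<lambda>_. borel)) (\<lambda>\<omega> i. X i \<omega>)"
  by (rule measurable_PiM_single') auto

text \<open>Independence is recast as a product law, checked on rectangles, so that Fubini's theorem
  becomes available.\<close>

lemma joint_distr_N_X:
  "distr M (count_space UNIV) (N n) \<Otimes>\<^sub>M distr M (PiM UNIV (\<lambda>_. borel)) (\<lambda>\<omega> i. X i \<omega>)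
    = distr M (count_space UNIV \<Otimes>\<^sub>M PiM UNIV (\<lambda>_. borel)) (\<lambda>\<omega>. (N n \<omega>, \<lambda>i. X i \<omega>))"
  (is "?A \<Otimes>\<^sub>M ?B = ?J")
proof (rule pair_measure_eqI)
  show "sigma_finite_measure ?A" "sigma_finite_measure ?B"
    by (auto intro!: prob_space_imp_sigma_finite prob_space_distr)
  show "sets (?A \<Otimes>\<^sub>M ?B) = sets ?J"
    unfolding sets_distr by (rule sets_pair_measure_cong) simp_all
  fix a b assume "a \<in> sets ?A" "b \<in> sets ?B"
  then have b [measurable]: "b \<in> sets (PiM UNIV (\<lambda>_. borel))" by simp
  have "prob ((N n -` a \<inter> space M) \<inter> ((\<lambda>\<omega> i. X i \<omega>) -` b \<inter> space M))
      = prob (N n -` a \<inter> space M) * prob ((\<lambda>\<omega> i. X i \<omega>) -` b \<inter> space M)"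
    by (rule indep_setD[OF N_indep[of n]]) (use b in auto)
  moreover have "(N n -` a \<inter> space M) \<inter> ((\<lambda>\<omega> i. X i \<omega>) -` b \<inter> space M)
      = (\<lambda>\<omega>. (N n \<omega>, \<lambda>i. X i \<omega>)) -` (a \<times> b) \<inter> space M"
    by auto
  ultimately show "emeasure ?A a * emeasure ?B b = emeasure ?J (a \<times> b)"
    by (simp add: emeasure_distr emeasure_eq_measure ennreal_mult[symmetric])
qed

text \<open>Fubini for the product law: the outer variable \<open>\<omega>'\<close> freezes the
  index while the inner integral averages over the summands. The general \<open>h\<close> serves
  both characteristic functions and tail probabilities.\<close>

lemma expectation_random_index:
  fixes h :: "nat \<Rightarrow> (nat \<Rightarrow> real) \<Rightarrow> 'b::{banach, second_countable_topology}"
  assumes h [measurable]: "\<And>k. h k \<in> borel_measurable (PiM UNIV (\<lambda>_. borel))"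
    and bdd: "\<And>k x. norm (h k x) \<le> C"
  shows "(\<integral>\<omega>. h (N n \<omega>) (\<lambda>i. X i \<omega>) \<partial>M) = (\<integral>\<omega>'. (\<integral>\<omega>. h (N n \<omega>') (\<lambda>i. X i \<omega>) \<partial>M) \<partial>M)"
proof -
  let ?S = "count_space UNIV :: nat measure" and ?T = "PiM UNIV (\<lambda>_. borel) :: (nat \<Rightarrow> real) measure"
  let ?X = "\<lambda>\<omega> i. X i \<omega>"
  have meas [measurable]: "case_prod h \<in> borel_measurable (?S \<Otimes>\<^sub>M ?T)"
    by (rule measurable_pair_measure_countable1) auto
  interpret P: pair_prob_space "distr M ?S (N n)" "distr M ?T ?X"
    by (intro pair_prob_space.intro pair_sigma_finite.intro prob_space_imp_sigma_finite
        prob_space_distr) simp_all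
  have "(\<integral>\<omega>. h (N n \<omega>) (?X \<omega>) \<partial>M) = (\<integral>p. case_prod h p \<partial>distr M (?S \<Otimes>\<^sub>M ?T) (\<lambda>\<omega>. (N n \<omega>, ?X \<omega>)))"
    by (subst integral_distr) auto
  also have "\<dots> = (\<integral>k. (\<integral>x. h k x \<partial>distr M ?T ?X) \<partial>distr M ?S (N n))"
    unfolding joint_distr_N_X[symmetric]
    by (subst P.integral_fst'[symmetric])
      (auto intro!: P.P.integrable_const_bound[where B=C] simp: bdd split: prod.split)
  also have "\<dots> = (\<integral>\<omega>'. (\<integral>x. h (N n \<omega>') x \<partial>distr M ?T ?X) \<partial>M)"
    by (subst integral_distr) auto
  also have "\<dots> = (\<integral>\<omega>'. (\<integral>\<omega>. h (N n \<omega>') (?X \<omega>) \<partial>M) \<partial>M)"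
    by (subst integral_distr) auto
  finally show ?thesis .
qed

text \<open>Given the index \<open>k\<close>, the sum over \<open>d n\<close> is the normalized sum
  times \<open>sqrt (V k) / d n\<close>, and that factor is
  \<open>sqrt (U n \<omega>)\<close>.\<close>

lemma char_random_sum: "char (distr M borel (Y n)) t = (\<integral>\<omega>. F (N n \<omega>) (t * sqrt (U n \<omega>)) \<partial>M)"
proof -
  have F_eq: "(\<integral>\<omega>. iexp (t * ((\<Sum>i<k. X i \<omega>) / d n)) \<partial>M) = F k (t * (sqrt (V k) / d n))" for k
  \<comment> \<open>For \<open>k = 0\<close> cancelling \<open>sqrt (V k)\<close> is impossible, but
    both sides are 1.\<close>
  proof (cases "k = 0")
    case True
    then show ?thesis unfolding F_def char_def by (subst integral_distr) auto
  next
    case False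
    then have "sqrt (V k) \<noteq> 0" using V_pos[of k] by simp
    then show ?thesis by (simp add: F_def char_def integral_distr)
  qed
  have "char (distr M borel (Y n)) t = (\<integral>\<omega>. iexp (t * ((\<Sum>i<N n \<omega>. X i \<omega>) / d n)) \<partial>M)"
    unfolding char_def by (subst integral_distr) (auto simp: Y_def)
  also have "\<dots> = (\<integral>\<omega>'. (\<integral>\<omega>. iexp (t * ((\<Sum>i<N n \<omega>'. X i \<omega>) / d n)) \<partial>M) \<partial>M)"
    by (rule expectation_random_index[where h="\<lambda>k x. iexp (t * ((\<Sum>i<k. x i) / d n))" and C=1]) auto
  also have "\<dots> = (\<integral>\<omega>. F (N n \<omega>) (t * sqrt (U n \<omega>)) \<partial>M)"
    unfolding F_eq sqrt_U ..
  finally show ?thesis .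
qed

lemma prob_random_sum:
  "prob {\<omega> \<in> space M. c < \<bar>Y n \<omega>\<bar>}
    = (\<integral>\<omega>'. prob {\<omega> \<in> space M. c < \<bar>(\<Sum>i<N n \<omega>'. X i \<omega>) / d n\<bar>} \<partial>M)"
proof -
  have prob_eq: "prob {\<omega> \<in> space M. P \<omega>} = (\<integral>\<omega>. of_bool (P \<omega>) \<partial>M)" for P
  proof -
    have "prob {\<omega> \<in> space M. P \<omega>} = (\<integral>\<omega>. indicator {\<omega> \<in> space M. P \<omega>} \<omega> \<partial>M)"
      by (auto intro!: arg_cong[where f=prob])
    also have "\<dots> = (\<integral>\<omega>. of_bool (P \<omega>) \<partial>M)"
      by (rule Bochner_Integration.integral_cong) (auto simp: indicator_def)
    finally show ?thesis .
  qed
  show ?thesis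
    unfolding prob_eq Y_def
    by (rule expectation_random_index[where h="\<lambda>k x. of_bool (c < \<bar>(\<Sum>i<k. x i) / d n\<bar>)" and C=1])
      auto
qed

section \<open>Comparison with Laplace transforms and transfer of tightness\<close>

lemma F_random_index_measurable [measurable]:
  "(\<lambda>\<omega>. F (N n \<omega>) (t * sqrt (U n \<omega>))) \<in> borel_measurable M"
  unfolding sqrt_U by measurable

text \<open>For \<open>N n \<omega> > m\<close> and \<open>U n \<omega> \<le> R\<close> the
  integrand is uniformly close to \<open>exp (- (t\<^sup>2 / 2) * U n \<omega>)\<close>. The two
  exceptional events have small probability, and there the difference is at most 2.\<close>

lemma char_random_sum_minus_Laplace_tendsto_0:
  assumes tight: "asymptotically_tight (\<lambda>n. distr M borel (U n))"
  shows "(\<lambda>n. char (distr M borel (Y n)) t - expectation (\<lambda>\<omega>. exp (- (t\<^sup>2 / 2) * U n \<omega>))) \<longlonglongrightarrow> 0"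
proof (rule tendstoI)
  fix \<epsilon> :: real assume "0 < \<epsilon>"
  then obtain R where "0 < R"
    and R: "\<forall>\<^sub>F n in sequentially. measure (distr M borel (U n)) {x. R < \<bar>x\<bar>} < \<epsilon> / 8"
    using tight unfolding asymptotically_tight_def by (meson divide_pos_pos zero_less_numeral)
  \<comment> \<open>The total error stays below
    \<open>\<epsilon> / 4 + 2 * (\<epsilon> / 8) + 2 * (\<epsilon> / 8)\<close>, which is less than
    \<open>\<epsilon>\<close>.\<close>
  obtain m where m: "\<And>k s. m \<le> k \<Longrightarrow> \<bar>s\<bar> \<le> \<bar>t\<bar> * sqrt R \<Longrightarrow> cmod (F k s - exp (- s\<^sup>2 / 2)) \<le> \<epsilon> / 4"
    using F_uniform_limit[of "\<bar>t\<bar> * sqrt R" "\<epsilon> / 4"] \<open>0 < \<epsilon>\<close> \<open>0 < R\<close> by auto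
  have N: "\<forall>\<^sub>F n in sequentially. prob {\<omega> \<in> space M. N n \<omega> \<le> m} < \<epsilon> / 8"
    using \<open>0 < \<epsilon>\<close> by (intro order_tendstoD[OF N_inf]) auto
  from R N show "\<forall>\<^sub>F n in sequentially. dist
    (char (distr M borel (Y n)) t - expectation (\<lambda>\<omega>. exp (- (t\<^sup>2 / 2) * U n \<omega>))) 0 < \<epsilon>"
  proof eventually_elim
    case (elim n)
    let ?f = "\<lambda>\<omega>. F (N n \<omega>) (t * sqrt (U n \<omega>))"
    let ?g = "\<lambda>\<omega>. exp (- (t\<^sup>2 / 2) * U n \<omega>)"
    let ?A = "{\<omega> \<in> space M. N n \<omega> \<le> m}" and ?B = "{\<omega> \<in> space M. R < \<bar>U n \<omega>\<bar>}"
    have g_le: "?g \<omega> \<le> 1" for \<omega>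
      using U_nonneg[of n \<omega>] by simp
    have f_int: "integrable M ?f"
      by (rule integrable_const_bound[where B=1]) (auto simp: cmod_F_le_1)
    have g_int: "integrable M ?g"
      by (rule integrable_const_bound[where B=1]) (use g_le in auto)
    have bound: "cmod (?f \<omega> - ?g \<omega>) \<le> \<epsilon> / 4 + 2 * indicator ?A \<omega> + 2 * indicator ?B \<omega>"
      if "\<omega> \<in> space M" for \<omega>
    proof (cases "\<omega> \<in> ?A \<or> \<omega> \<in> ?B")
      case True
      have "cmod (?f \<omega> - ?g \<omega>) \<le> 2"
        using norm_triangle_ineq4[of "?f \<omega>" "complex_of_real (?g \<omega>)"]
          cmod_F_le_1[of "N n \<omega>" "t * sqrt (U n \<omega>)"] g_le[of \<omega>]
        unfolding norm_of_real abs_exp_cancel by linarith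
      moreover have "(2::real) \<le> 2 * indicator ?A \<omega> + 2 * indicator ?B \<omega>"
        using True by (auto simp: indicator_def)
      ultimately show ?thesis using \<open>0 < \<epsilon>\<close> by linarith
    next
      case False
      with that have *: "m \<le> N n \<omega>" "U n \<omega> \<le> R" by auto
      have "\<bar>t * sqrt (U n \<omega>)\<bar> \<le> \<bar>t\<bar> * sqrt R"
        using * U_nonneg[of n \<omega>] by (auto simp: abs_mult intro!: mult_left_mono)
      from m[OF *(1) this] show ?thesis
        using False U_nonneg[of n \<omega>] by (simp add: power_mult_distrib)
    qed
    have "cmod (char (distr M borel (Y n)) t - expectation ?g)
        = cmod (\<integral>\<omega>. ?f \<omega> - ?g \<omega> \<partial>M)"
      using f_int g_int by (simp add: char_random_sum)
    also have "\<dots> \<le> expectation (\<lambda>\<omega>. \<epsilon> / 4 + 2 * indicator ?A \<omega> + 2 * indicator ?B \<omega>)"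
    proof (rule norm_integral_le_integral)
      show "integrable M (\<lambda>\<omega>. ?f \<omega> - ?g \<omega>)"
        using f_int g_int by auto
      show "integrable M (\<lambda>\<omega>. \<epsilon> / 4 + 2 * indicator ?A \<omega> + 2 * indicator ?B \<omega>)"
        by (intro Bochner_Integration.integrable_add Bochner_Integration.integrable_mult_right
            expectation_indicator_event) auto
    qed (rule bound)
    also have "\<dots> = \<epsilon> / 4 + 2 * prob ?A + 2 * prob ?B"
      by (simp add: expectation_indicator_event prob_space)
    also have "\<dots> < \<epsilon>"
      using elim \<open>0 < \<epsilon>\<close> unfolding measure_distr_abs_gt[OF U_measurable] by linarith
    finally show ?case by simp
  qed
qed

text \<open>As \<open>\<bar>exp (\<i> z) - 1\<bar> \<le> 1 / 8\<close> for \<open>\<bar>z\<bar> \<le> 1 / 8\<close>, too much mass near the origin would force the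
  characteristic function at 1 closer to 1 than its Gaussian limit \<open>exp (- 1 / 2)\<close>.\<close>

lemma normalized_sum_anticoncentration:
  "\<exists>m>0. \<forall>k\<ge>m. 1 / 10 \<le> prob {\<omega> \<in> space M. 1 / 8 < \<bar>(\<Sum>i<k. X i \<omega>) / sqrt (V k)\<bar>}"
proof -
  obtain m where "0 < m"
    and m': "\<forall>k\<ge>m. \<forall>s. \<bar>s\<bar> \<le> 1 \<longrightarrow> cmod (F k s - exp (- s\<^sup>2 / 2)) \<le> 1 / 100"
    using F_uniform_limit[of 1 "1 / 100"] by auto
  have m: "cmod (F k 1 - complex_of_real (exp (- 1 / 2))) \<le> 1 / 100" if "m \<le> k" for k
    using m'[rule_format, OF that, of 1] by simp
  have "1 / 10 \<le> prob {\<omega> \<in> space M. 1 / 8 < \<bar>(\<Sum>i<k. X i \<omega>) / sqrt (V k)\<bar>}" if "m \<le> k" for k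
  proof -
    let ?Z = "\<lambda>\<omega>. (\<Sum>i<k. X i \<omega>) / sqrt (V k)"
    let ?A = "{\<omega> \<in> space M. 1 / 8 < \<bar>?Z \<omega>\<bar>}"
    have int: "integrable M (\<lambda>\<omega>. iexp (?Z \<omega>))"
      by (rule integrable_const_bound[where B=1]) (auto simp only: norm_exp_i_times intro!: AE_I2, measurable)
    have "F k 1 - 1 = (\<integral>\<omega>. iexp (?Z \<omega>) - 1 \<partial>M)"
      unfolding F_def char_def using int by (subst integral_distr) (auto simp: prob_space)
    also have "cmod \<dots> \<le> expectation (\<lambda>\<omega>. 1 / 8 + 2 * indicator ?A \<omega>)"
    proof (rule norm_integral_le_integral)
      show "integrable M (\<lambda>\<omega>. iexp (?Z \<omega>) - 1)"
        using int by auto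
      show "integrable M (\<lambda>\<omega>. 1 / 8 + 2 * indicator ?A \<omega> :: real)"
        by (intro Bochner_Integration.integrable_add Bochner_Integration.integrable_mult_right
            expectation_indicator_event) measurable
      fix \<omega> assume "\<omega> \<in> space M"
      show "cmod (iexp (?Z \<omega>) - 1) \<le> 1 / 8 + 2 * indicator ?A \<omega>"
      proof (cases "\<omega> \<in> ?A")
        case True
        have "cmod (iexp (?Z \<omega>) - 1) \<le> 2"
          using norm_triangle_ineq4[of "iexp (?Z \<omega>)" 1] by simp
        then show ?thesis using True by simp
      next
        case False
        have "cmod (iexp (?Z \<omega>) - 1) \<le> \<bar>?Z \<omega>\<bar>"
          using iexp_approx1[of "?Z \<omega>" 0] by simp
        moreover have "\<bar>?Z \<omega>\<bar> \<le> 1 / 8"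
          using False \<open>\<omega> \<in> space M\<close> by (simp only: mem_Collect_eq simp_thms not_less)
        moreover have "indicator ?A \<omega> = (0::real)"
          using False by (rule indicator_simps)
        ultimately show ?thesis by linarith
      qed
    qed
    also have "\<dots> = 1 / 8 + 2 * prob ?A"
      by (simp add: expectation_indicator_event prob_space)
    finally have upper: "cmod (F k 1 - 1) \<le> 1 / 8 + 2 * prob ?A" .
    \<comment> \<open>The limit \<open>exp (- 1 / 2)\<close> is at least 3/8 away from 1.
      Subtracting 1/8 and the approximation error 1/100 leaves 24/100 for
      \<open>2 * prob ?A\<close>, so \<open>prob ?A\<close> is at least 12/100.\<close>
    have "exp (- 1 / 2 :: real) \<le> 5 / 8"
      using abs_le_D1[OF abs_exp_minus_linear_le[of "1 / 2"]] by (simp add: power2_eq_square)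
    then have "3 / 8 \<le> cmod (1 - complex_of_real (exp (- 1 / 2)))"
      unfolding of_real_1[symmetric, where 'a=complex] of_real_diff[symmetric] norm_of_real
      by simp
    also have "\<dots> \<le> cmod (F k 1 - 1) + cmod (F k 1 - complex_of_real (exp (- 1 / 2)))"
      using norm_triangle_ineq[of "1 - F k 1" "F k 1 - complex_of_real (exp (- 1 / 2))"] by (simp add: norm_minus_commute)
    finally show ?thesis
      using m[OF that] upper by simp
  qed
  with \<open>0 < m\<close> show ?thesis by blast
qed

text \<open>Once the index is large, a large \<open>U n\<close> forces the random sum to be large
  with conditional probability at least 1/10. Hence the tail of \<open>U n\<close> is at most
  \<open>prob {N n \<le> m}\<close> plus ten times the tail of \<open>Y n\<close>.\<close>

lemma asymptotically_tight_U_if_random_sum: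
  assumes tight: "asymptotically_tight (\<lambda>n. distr M borel (Y n))"
  shows "asymptotically_tight (\<lambda>n. distr M borel (U n))"
  unfolding asymptotically_tight_def
proof (intro allI impI)
  fix \<epsilon> :: real assume "0 < \<epsilon>"
  then obtain R where "0 < R"
    and R: "\<forall>\<^sub>F n in sequentially. measure (distr M borel (Y n)) {x. R < \<bar>x\<bar>} < \<epsilon> / 20"
    using tight unfolding asymptotically_tight_def by (meson divide_pos_pos zero_less_numeral)
  obtain m where "0 < m"
    and m: "\<And>k. m \<le> k \<Longrightarrow> 1 / 10 \<le> prob {\<omega> \<in> space M. 1 / 8 < \<bar>(\<Sum>i<k. X i \<omega>) / sqrt (V k)\<bar>}"
    using normalized_sum_anticoncentration by blast
  have N: "\<forall>\<^sub>F n in sequentially. prob {\<omega> \<in> space M. N n \<omega> \<le> m} < \<epsilon> / 2"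
    using \<open>0 < \<epsilon>\<close> by (intro order_tendstoD[OF N_inf]) auto
  \<comment> \<open>The level \<open>(8 * R)\<^sup>2\<close> matches the anticoncentration radius
    1/8: if \<open>sqrt (U n \<omega>)\<close> exceeds \<open>8 * R\<close> and the normalized sum
    exceeds 1/8 in modulus, their product exceeds \<open>R\<close>.\<close>
  from R N have "\<forall>\<^sub>F n in sequentially. measure (distr M borel (U n)) {x. (8 * R)\<^sup>2 < \<bar>x\<bar>} < \<epsilon>"
  proof eventually_elim
    case (elim n)
    let ?A = "{\<omega> \<in> space M. N n \<omega> \<le> m}" and ?B = "{\<omega> \<in> space M. (8 * R)\<^sup>2 < \<bar>U n \<omega>\<bar>}"
    let ?p = "\<lambda>\<omega>'. prob {\<omega> \<in> space M. R < \<bar>(\<Sum>i<N n \<omega>'. X i \<omega>) / d n\<bar>}"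
    have p_int: "integrable M ?p"
      by (rule integrable_const_bound[where B=1]) auto
    have bound: "indicator ?B \<omega> \<le> indicator ?A \<omega> + 10 * ?p \<omega>" if "\<omega> \<in> space M" for \<omega>
    proof (cases "\<omega> \<in> ?B \<and> \<omega> \<notin> ?A")
      case True
      define k where "k = N n \<omega>"
      have "m \<le> k" using True that by (auto simp: k_def)
      have "sqrt ((8 * R)\<^sup>2) < sqrt (U n \<omega>)"
        using True U_nonneg[of n \<omega>] by (intro real_sqrt_less_mono) auto
      then have B: "8 * R < sqrt (V k) / d n"
        unfolding real_sqrt_abs sqrt_U k_def[symmetric] using \<open>0 < R\<close> by simp
      have "0 < V k" using \<open>0 < m\<close> \<open>m \<le> k\<close> by (intro V_pos) auto
      have "1 / 10 \<le> prob {\<omega> \<in> space M. 1 / 8 < \<bar>(\<Sum>i<k. X i \<omega>) / sqrt (V k)\<bar>}"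
        by (rule m) fact
      also have "\<dots> \<le> ?p \<omega>"
        unfolding k_def[symmetric]
      proof (rule finite_measure_mono)
        show "{\<omega> \<in> space M. 1 / 8 < \<bar>(\<Sum>i<k. X i \<omega>) / sqrt (V k)\<bar>}
            \<subseteq> {\<omega> \<in> space M. R < \<bar>(\<Sum>i<k. X i \<omega>) / d n\<bar>}"
        proof safe
          fix \<omega> assume *: "1 / 8 < \<bar>(\<Sum>i<k. X i \<omega>) / sqrt (V k)\<bar>"
          have "R = 1 / 8 * (8 * R)" by simp
          also have "\<dots> < \<bar>(\<Sum>i<k. X i \<omega>) / sqrt (V k)\<bar> * (sqrt (V k) / d n)"
            by (rule mult_strict_mono) (use * B \<open>0 < R\<close> in linarith)+
          also have "\<dots> = \<bar>(\<Sum>i<k. X i \<omega>) / d n\<bar>"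
            using \<open>0 < V k\<close> d_pos[of n] by (simp add: abs_mult)
          finally show "R < \<bar>(\<Sum>i<k. X i \<omega>) / d n\<bar>" .
        qed
      qed measurable
      finally show ?thesis using True by simp
    next
      case False
      then show ?thesis by (auto simp: indicator_def)
    qed
    have "prob ?B = expectation (indicator ?B)"
      by (rule expectation_indicator_event(1)[symmetric]) measurable
    also have "\<dots> \<le> expectation (\<lambda>\<omega>. indicator ?A \<omega> + 10 * ?p \<omega>)"
    proof (rule integral_mono)
      show "integrable M (indicator ?B :: _ \<Rightarrow> real)"
        by (rule expectation_indicator_event) measurable
      show "integrable M (\<lambda>\<omega>. indicator ?A \<omega> + 10 * ?p \<omega>)"
        by (intro Bochner_Integration.integrable_add Bochner_Integration.integrable_mult_right
            expectation_indicator_event p_int) measurable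
    qed (rule bound)
    also have "\<dots> = prob ?A + 10 * prob {\<omega> \<in> space M. R < \<bar>Y n \<omega>\<bar>}"
      unfolding prob_random_sum
      by (subst Bochner_Integration.integral_add)
        (auto simp: expectation_indicator_event p_int simp del: abs_divide)
    also have "\<dots> < \<epsilon>"
      using elim by (simp add: measure_distr_abs_gt)
    finally show ?case by (simp add: measure_distr_abs_gt)
  qed
  moreover have "0 < (8 * R)\<^sup>2" using \<open>0 < R\<close> by simp
  ultimately show "\<exists>R>0. \<forall>\<^sub>F n in sequentially. measure (distr M borel (U n)) {x. R < \<bar>x\<bar>} < \<epsilon>"
    by blast
qed

section \<open>The two implications\<close>

lemma real_distribution_U: "real_distribution (distr M borel (U n))"
  by (rule real_distribution_distr) measurable

lemma real_distribution_Y: "real_distribution (distr M borel (Y n))"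
  by (rule real_distribution_distr) measurable

lemma AE_distr_U_nonneg: "AE x in distr M borel (U n). 0 \<le> x"
  by (subst AE_distr_iff) (auto simp: U_nonneg)

lemma Laplace_distr_U: "(\<integral>x. exp (- s * x) \<partial>distr M borel (U n)) = expectation (\<lambda>\<omega>. exp (- s * U n \<omega>))"
  by (subst integral_distr) auto

text \<open>The Laplace transforms of \<open>U n\<close> at \<open>t\<^sup>2 / 2\<close> converge to
  that of \<open>\<mu>\<close> at \<open>t\<^sup>2\<close>, which is the characteristic function of
  the Gaussian mixture over \<open>\<mu>\<close>. Levy's continuity theorem gives the convergence,
  and the Mittag-Leffler transform identifies the limit.\<close>

lemma random_sum_conv_if_U_conv:
  assumes "is_ML_law (\<alpha> / 2) \<nu> \<mu>"
    and conv: "weak_conv_m (\<lambda>n. distr M borel (U n)) (distr \<mu> borel (\<lambda>x. 2 * x))"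
  shows "conv_in_dist_L M Y \<alpha> \<nu>"
proof -
  from assms(1) have \<mu>: "real_distribution \<mu>" "AE x in \<mu>. 0 \<le> x"
    and Laplace: "\<And>s. 0 \<le> s \<Longrightarrow> (\<integral>x. exp (- s * x) \<partial>\<mu>) = (1 + s powr (\<alpha> / 2)) powr (- \<nu>)"
    unfolding is_ML_law_def by auto
  interpret \<mu>: real_distribution \<mu> by fact
  let ?\<mu>2 = "distr \<mu> borel (\<lambda>x. 2 * x)"
  have \<mu>2: "real_distribution ?\<mu>2"
    by (rule \<mu>.real_distribution_distr) measurable
  obtain \<eta> where \<eta>: "real_distribution \<eta>"
    and char_\<eta>: "\<And>t. char \<eta> t = complex_of_real (\<integral>x. exp (- t\<^sup>2 * x) \<partial>\<mu>)"
    using gaussian_scale_mixture_exists[OF \<mu>] by blast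
  have "weak_conv_m (\<lambda>n. distr M borel (Y n)) \<eta>"
  proof (rule levy_continuity[OF real_distribution_Y \<eta>])
    fix t
    have "(\<integral>x. exp (- (t\<^sup>2 / 2) * x) \<partial>?\<mu>2) = (\<integral>x. exp (- t\<^sup>2 * x) \<partial>\<mu>)"
      by (subst integral_distr) auto
    then have "(\<lambda>n. complex_of_real (expectation (\<lambda>\<omega>. exp (- (t\<^sup>2 / 2) * U n \<omega>)))) \<longlonglongrightarrow> char \<eta> t"
      using weak_conv_m_Laplace[OF real_distribution_U \<mu>2 conv AE_distr_U_nonneg, of "t\<^sup>2 / 2"]
      unfolding char_\<eta> Laplace_distr_U by (intro tendsto_of_real) simp
    from tendsto_add[OF char_random_sum_minus_Laplace_tendsto_0[OF
          weak_conv_m_imp_asymptotically_tight[OF real_distribution_U \<mu>2 conv], of t] this]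
    show "(\<lambda>n. char (distr M borel (Y n)) t) \<longlonglongrightarrow> char \<eta> t"
      by simp
  qed
  moreover have "is_L_law \<alpha> \<nu> \<eta>"
    unfolding is_L_law_def
  proof (intro conjI \<eta> allI)
    fix t
    have "(t\<^sup>2) powr (\<alpha> / 2) = \<bar>t\<bar> powr \<alpha>"
    proof -
      have "(t\<^sup>2) powr (\<alpha> / 2) = ((t\<^sup>2) powr (1 / 2)) powr \<alpha>"
        unfolding powr_powr by simp
      then show ?thesis by (simp add: powr_half_sqrt)
    qed
    then show "char \<eta> t = complex_of_real ((1 + \<bar>t\<bar> powr \<alpha>) powr (- \<nu>))"
      by (simp only: char_\<eta> Laplace[OF zero_le_power2])
  qed
  ultimately show ?thesis
    unfolding conv_in_dist_L_def by blast
qed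

text \<open>The Mittag-Leffler law itself has to be produced here. It comes from a subsequential
  weak limit of the laws of \<open>U n\<close>, whose Laplace transform is forced to be
  \<open>\<Phi>\<close>.\<close>

lemma U_conv_if_random_sum_conv:
  assumes "is_L_law \<alpha> \<nu> \<eta>"
    and conv: "weak_conv_m (\<lambda>n. distr M borel (Y n)) \<eta>"
  shows "conv_in_dist_cML M U 2 (\<alpha> / 2) \<nu>"
proof -
  let ?U = "\<lambda>n. distr M borel (U n)"
  \<comment> \<open>\<open>\<Phi>\<close> is the prescribed Laplace transform of twice a
    Mittag-Leffler variable; it is the value of \<open>char \<eta>\<close> at
    \<open>t = sqrt (2 * s)\<close>, for which \<open>t\<^sup>2 / 2 = s\<close>.\<close>
  define \<Phi> where "\<Phi> s = (1 + (2 * s) powr (\<alpha> / 2)) powr (- \<nu>)" for s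
  from assms(1) have \<eta>: "real_distribution \<eta>"
    and char_\<eta>: "\<And>t. char \<eta> t = complex_of_real ((1 + \<bar>t\<bar> powr \<alpha>) powr (- \<nu>))"
    unfolding is_L_law_def by auto
  have as_tight: "asymptotically_tight ?U"
    by (intro asymptotically_tight_U_if_random_sum
        weak_conv_m_imp_asymptotically_tight[OF real_distribution_Y \<eta> conv])
  then have tight: "tight ?U"
    by (rule asymptotically_tight_imp_tight[OF real_distribution_U])
  have Laplace_U: "(\<lambda>n. \<integral>x. exp (- s * x) \<partial>?U n) \<longlonglongrightarrow> \<Phi> s" if "0 \<le> s" for s
  proof -
    define t where "t = sqrt (2 * s)"
    have t: "0 \<le> t" "t\<^sup>2 / 2 = s"
      using that by (auto simp: t_def)
    have "t powr \<alpha> = (2 * s) powr (\<alpha> / 2)"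
      using that by (simp add: t_def powr_half_sqrt[symmetric] powr_powr)
    then have "char \<eta> t = complex_of_real (\<Phi> s)"
      using t by (simp add: char_\<eta> \<Phi>_def)
    then have "(\<lambda>n. char (distr M borel (Y n)) t) \<longlonglongrightarrow> complex_of_real (\<Phi> s)"
      using levy_continuity1[OF real_distribution_Y \<eta> conv, of t] by simp
    from tendsto_diff[OF this char_random_sum_minus_Laplace_tendsto_0[OF as_tight, of t]]
    have "(\<lambda>n. complex_of_real (expectation (\<lambda>\<omega>. exp (- s * U n \<omega>)))) \<longlonglongrightarrow> complex_of_real (\<Phi> s)"
      by (simp add: t)
    then show ?thesis
      unfolding Laplace_distr_U tendsto_of_real_iff .
  qed
  \<comment> \<open>This is stated for arbitrary subsequences since it is used twice: to construct
    \<open>\<rho>\<close> and to show that no other subsequential limit exists.\<close>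
  have subseq_limit: "AE x in \<rho>. 0 \<le> x" "\<And>s. 0 \<le> s \<Longrightarrow> (\<integral>x. exp (- s * x) \<partial>\<rho>) = \<Phi> s"
    if "strict_mono r" and \<rho>: "real_distribution \<rho>" and lim: "weak_conv_m (?U \<circ> r) \<rho>" for r \<rho>
  proof -
    have rd: "real_distribution ((?U \<circ> r) n)" and nonneg: "AE x in (?U \<circ> r) n. 0 \<le> x" for n
      unfolding comp_def by (rule real_distribution_U, rule AE_distr_U_nonneg)
    show "AE x in \<rho>. 0 \<le> x"
      by (rule weak_conv_m_AE_nonneg[OF rd \<rho> lim nonneg])
    fix s :: real assume "0 \<le> s"
    have "(\<lambda>n. \<integral>x. exp (- s * x) \<partial>(?U \<circ> r) n) \<longlonglongrightarrow> (\<integral>x. exp (- s * x) \<partial>\<rho>)"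
      by (rule weak_conv_m_Laplace[OF rd \<rho> lim nonneg \<open>0 \<le> s\<close>])
    moreover have "(\<lambda>n. \<integral>x. exp (- s * x) \<partial>(?U \<circ> r) n) \<longlonglongrightarrow> \<Phi> s"
      using LIMSEQ_subseq_LIMSEQ[OF Laplace_U[OF \<open>0 \<le> s\<close>] \<open>strict_mono r\<close>] by (simp add: comp_def)
    ultimately show "(\<integral>x. exp (- s * x) \<partial>\<rho>) = \<Phi> s"
      by (rule LIMSEQ_unique)
  qed
  obtain r \<rho> where r: "strict_mono r" and \<rho>: "real_distribution \<rho>" and lim: "weak_conv_m (?U \<circ> r) \<rho>"
    using tight_imp_convergent_subsubsequence[OF tight strict_mono_id] by auto
  note \<rho>_props = subseq_limit[OF r \<rho> lim]
  have conv_\<rho>: "weak_conv_m ?U \<rho>"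
  proof (rule tight_subseq_weak_converge[OF real_distribution_U \<rho> tight])
    fix r' \<rho>'
    assume *: "strict_mono r'" "real_distribution \<rho>'" "weak_conv_m (?U \<circ> r') \<rho>'"
    have "\<rho>' = \<rho>"
      by (rule real_distribution_eq_if_Laplace_eq)
        (use * \<rho> \<rho>_props subseq_limit[OF *] in auto)
    with * show "weak_conv_m (?U \<circ> r') \<rho>" by simp
  qed
  interpret \<rho>: real_distribution \<rho> by fact
  \<comment> \<open>Halving undoes the factor 2 in the limit law.\<close>
  define \<mu> where "\<mu> = distr \<rho> borel (\<lambda>x. x / 2)"
  have "is_ML_law (\<alpha> / 2) \<nu> \<mu>"
    unfolding is_ML_law_def
  proof (intro conjI allI impI)
    show "real_distribution \<mu>"
      unfolding \<mu>_def by (rule \<rho>.real_distribution_distr) measurable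
    show "AE x in \<mu>. 0 \<le> x"
      unfolding \<mu>_def by (subst AE_distr_iff) (use \<rho>_props(1) in auto)
    fix s :: real assume "0 \<le> s"
    have "(\<integral>x. exp (- s * x) \<partial>\<mu>) = (\<integral>x. exp (- (s / 2) * x) \<partial>\<rho>)"
      unfolding \<mu>_def by (subst integral_distr) auto
    also have "\<dots> = (1 + s powr (\<alpha> / 2)) powr (- \<nu>)"
      using \<rho>_props(2)[of "s / 2"] \<open>0 \<le> s\<close> by (simp add: \<Phi>_def)
    finally show "(\<integral>x. exp (- s * x) \<partial>\<mu>) = (1 + s powr (\<alpha> / 2)) powr (- \<nu>)" .
  qed
  moreover have "distr \<mu> borel (\<lambda>x. 2 * x) = \<rho>"
    unfolding \<mu>_def by (subst distr_distr) (auto simp: comp_def distr_id2)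
  ultimately show ?thesis
    unfolding conv_in_dist_cML_def using conv_\<rho> by metis
qed

end

text \<open>Each side asserts the existence of its limit law along with the convergence, so each
  implication constructs the law on the other side.\<close>

theorem theorem7:
  fixes M :: "'a measure" and X :: "nat \<Rightarrow> 'a \<Rightarrow> real" and N :: "nat \<Rightarrow> 'a \<Rightarrow> nat"
    and d :: "nat \<Rightarrow> real" and \<alpha> \<nu> :: real
  assumes "prob_space M"
    and "0 < \<alpha>" and "\<alpha> \<le> 2" and "0 < \<nu>"
    and X_rv: "\<And>i. X i \<in> borel_measurable M"
    and X_indep: "prob_space.indep_vars M (\<lambda>_. borel) X UNIV"
    and X_sq_int: "\<And>i. integrable M (\<lambda>\<omega>. (X i \<omega>)\<^sup>2)"
    and X_mean: "\<And>i. prob_space.expectation M (X i) = 0"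
    and X_var_pos: "\<And>i. 0 < prob_space.variance M (X i)"
    and Lindeberg: "\<And>\<tau>. \<tau> > 0 \<Longrightarrow>
      (\<lambda>n. (\<Sum>i<n. prob_space.expectation M
              (\<lambda>\<omega>. (X i \<omega>)\<^sup>2 * indicator {x. \<bar>x\<bar> \<ge> \<tau> * sqrt (\<Sum>j<n. prob_space.variance M (X j))} (X i \<omega>)))
           / (\<Sum>j<n. prob_space.variance M (X j))) \<longlonglongrightarrow> 0"
    and N_rv: "\<And>n. N n \<in> measurable M (count_space UNIV)"
    and N_indep: "\<And>n. prob_space.indep_set M
                     {N n -` A \<inter> space M | A. True}
                     {(\<lambda>\<omega> i. X i \<omega>) -` B \<inter> space M | B. B \<in> sets (PiM UNIV (\<lambda>_. borel))}"
    and N_inf: "\<And>m. (\<lambda>n. prob_space.prob M {\<omega> \<in> space M. N n \<omega> \<le> m}) \<longlonglongrightarrow> 0"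
    and d_pos: "\<And>n. 0 < d n"
    and d_inf: "filterlim d at_top sequentially"
  shows "conv_in_dist_L M (\<lambda>n \<omega>. (\<Sum>i<N n \<omega>. X i \<omega>) / d n) \<alpha> \<nu> \<longleftrightarrow>
         conv_in_dist_cML M (\<lambda>n \<omega>. (\<Sum>j<N n \<omega>. prob_space.variance M (X j)) / (d n)\<^sup>2) 2 (\<alpha>/2) \<nu>"
proof -
  interpret lindeberg_random_sum M X N d
    by (intro lindeberg_random_sum.intro lindeberg_random_sum_axioms.intro) (fact assms)+
  have "conv_in_dist_L M Y \<alpha> \<nu> \<longleftrightarrow> conv_in_dist_cML M U 2 (\<alpha> / 2) \<nu>"
  proof
    assume "conv_in_dist_L M Y \<alpha> \<nu>"
    then show "conv_in_dist_cML M U 2 (\<alpha> / 2) \<nu>"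
      unfolding conv_in_dist_L_def by (auto intro: U_conv_if_random_sum_conv)
  next
    assume "conv_in_dist_cML M U 2 (\<alpha> / 2) \<nu>"
    then show "conv_in_dist_L M Y \<alpha> \<nu>"
      unfolding conv_in_dist_cML_def by (auto intro: random_sum_conv_if_U_conv)
  qed
  then show ?thesis
    unfolding Y_def[abs_def] U_def[abs_def] V_def .
qed

end
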